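(* For the cardinality $n$ of a $q^r$-divisible set $\mathcal{C}$ over $\mathbb{F}_q$ we have $$n\notin\left[(a(q-1)+b)\frac{q^{r+1}-1}{q-1}+a+1,\ (a(q-1)+b+1)\frac{q^{r+1}-1}{q-1}-1\right],$$ where $a,b\in\mathbb{N}_0$ with $b\le q-2$, $a\le r-1$, and $r\in\mathbb{N}_{>0}$. In other words, if $n\le rq^{r+1}$, then $n$ can be written as $a\frac{q^{r+1}-1}{q-1}+bq^{r+1}$ for some $a,b\in\mathbb{N}_0$.
   Context: $q$ is a prime power. A set $\mathcal{C}$ of points ($1$-dimensional subspaces) of $\mathbb{F}_q^v$ is called $q^r$-divisible if $|\{P\in\mathcal{C}: P\subseteq H\}|\equiv|\mathcal{C}|\pmod{q^r}$ for every hyperplane $H$ of $\mathbb{F}_q^v$; a $q^r$-divisible set over $\mathbb{F}_q$ means such a set for some ambient dimension $v$. *)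

theory Defs
  imports "HOL-Analysis.Cartesian_Space" "HOL-Number_Theory.Cong"
begin

definition point :: "('a::field ^ 'n::finite) set \<Rightarrow> bool" where
  "point P \<longleftrightarrow> vec.subspace P \<and> vec.dim P = 1"

definition hyperplane :: "('a::field ^ 'n::finite) set \<Rightarrow> bool" where
  "hyperplane H \<longleftrightarrow> vec.subspace H \<and> vec.dim H = CARD('n) - 1"

text \<open>The base field is the finite type \<open>'a\<close>, so \<open>q = CARD('a)\<close>; points and
  hyperplanes are linear (not projective) subspaces of \<open>'a ^ 'n\<close>.\<close>

definition divisible_set :: "nat \<Rightarrow> ('a::{field,finite} ^ 'n::finite) set set \<Rightarrow> bool" where
  "divisible_set r \<C> \<longleftrightarrow>
     (\<forall>P\<in>\<C>. point P) \<and>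
     (\<forall>H. hyperplane H \<longrightarrow> [card {P \<in> \<C>. P \<subseteq> H} = card \<C>] (mod CARD('a) ^ r))"

end

theory Submission imports Defs begin

text \<open>Represent the points by nonzero vectors and count, for every linear functional \<open>f\<close>, the
  vectors outside its kernel: \<open>q ^ r\<close>-divisibility makes this number \<open>t * q ^ r\<close>. Put \<open>Q = q ^ (r + 1)\<close>,
  \<open>s = (Q - 1) / (q - 1)\<close> and suppose \<open>n = m * s + c\<close> with \<open>m = a * (q - 1) + b\<close> lies in an excluded
  interval; let \<open>s' = s - q ^ r\<close> be the value of \<open>s\<close> for \<open>r - 1\<close>.
  If \<open>c > s'\<close>, summing \<open>(t - m) * (t - m - 1) \<ge> 0\<close> over all \<open>f\<close> is contradictory, since distinct
  points impose independent conditions on \<open>f\<close>. If \<open>c \<le> s'\<close>, some kernel contains at most \<open>n / q\<close> of the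
  vectors; they form a \<open>q ^ (r - 1)\<close>-divisible set of size \<open>((a - u) * (q - 1) + b) * s' + (c - u)\<close> with
  \<open>u \<ge> 1\<close>, which is negative or excluded by induction on \<open>r\<close>.\<close>

section \<open>Functionals as dot products, their kernels and annihilators\<close>

definition dot :: "'a::field ^ 'n::finite \<Rightarrow> 'a ^ 'n \<Rightarrow> 'a" where
  "dot f x = (\<Sum>i\<in>UNIV. f $ i * x $ i)"

lemma dot_add_left: "dot (f + g) x = dot f x + dot g x"
  by (simp add: dot_def algebra_simps sum.distrib)

lemma dot_add_right: "dot f (x + y) = dot f x + dot f y"
  by (simp add: dot_def algebra_simps sum.distrib)

lemma dot_scale_left: "dot (c *s f) x = c * dot f x"
  by (simp add: dot_def algebra_simps sum_distrib_left)

lemma dot_scale_right: "dot f (c *s x) = c * dot f x"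
  by (simp add: dot_def algebra_simps sum_distrib_left)

lemma dot_zero [simp]: "dot 0 x = 0" "dot f 0 = 0"
  by (simp_all add: dot_def)

lemma dot_axis_left: "dot (axis i c) x = c * x $ i"
  by (simp add: dot_def axis_def if_distrib [of "\<lambda>u. u * _"] sum.delta cong: if_cong)

lemma dot_commute: "dot f x = dot x f"
  by (simp add: dot_def mult.commute)

lemma dot_diff_right: "dot f (x - y) = dot f x - dot f y"
  by (simp add: dot_def algebra_simps sum_subtractf)

lemma dot_diff_left: "dot (f - g) x = dot f x - dot g x"
  by (simp add: dot_def algebra_simps sum_subtractf)

lemma exists_dot_eq_1:
  assumes "x \<noteq> 0"
  shows "\<exists>g. dot g x = 1"
proof -
  obtain i where "x $ i \<noteq> 0" using assms by (auto simp: vec_eq_iff)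
  then have "dot (axis i (1 / x $ i)) x = 1" by (simp add: dot_axis_left)
  then show ?thesis by blast
qed

lemma exists_dot_eq_0_1:
  assumes "x \<noteq> 0" and indep: "\<And>c. y \<noteq> c *s x"
  shows "\<exists>g. dot g x = 0 \<and> dot g y = 1"
proof -
  obtain i where i: "x $ i \<noteq> 0" using assms(1) by (auto simp: vec_eq_iff)
  obtain j where j: "y $ j \<noteq> (y $ i / x $ i) * x $ j"
    using indep [of "y $ i / x $ i"] by (auto simp: vec_eq_iff)
  define d where "d = y $ j - (y $ i / x $ i) * x $ j"
  have "d \<noteq> 0" using j by (simp add: d_def)
  \<comment> \<open>Coordinate \<open>j\<close> corrected by a multiple of coordinate
    \<open>i\<close> so as to kill \<open>x\<close>; \<open>d\<close> is the value of this
    combination at \<open>y\<close>.\<close>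
  define g where "g = (1 / d) *s (axis j 1 + axis i (- (x $ j / x $ i)))"
  have "dot g x = 0" "dot g y = 1"
    using i \<open>d \<noteq> 0\<close> unfolding g_def dot_scale_left dot_add_left dot_axis_left
    by (simp_all add: d_def field_simps)
  then show ?thesis by blast
qed

text \<open>A vector \<open>g\<close> with \<open>dot f g = 1\<close> complements the kernel, since
  \<open>x - dot f x *s g\<close> always lies in it; so adjoining \<open>g\<close> raises the
  dimension by one and fills the space.\<close>

lemma hyperplane_kernel:
  fixes f :: "'a::field ^ 'n::finite"
  assumes "f \<noteq> 0"
  shows "hyperplane {x. dot f x = 0}"
proof -
  let ?H = "{x. dot f x = 0}"
  have sub: "vec.subspace ?H"
    by (auto simp: vec.subspace_def dot_add_right dot_scale_right)
  obtain g where g: "dot f g = 1"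
    using exists_dot_eq_1 [OF assms] dot_commute by metis
  have sp: "vec.span ?H = ?H" using sub by (simp add: vec.span_eq_iff)
  have "x \<in> vec.span (insert g ?H)" for x
  proof -
    have "x - dot f x *s g \<in> ?H"
      by (simp add: dot_diff_right dot_scale_right g)
    then show ?thesis unfolding vec.span_insert sp by blast
  qed
  then have "vec.span (insert g ?H) = UNIV" by blast
  then have "vec.dim (insert g ?H) = CARD('n)"
    by (metis vec.dim_span vec_dim_card)
  moreover have "g \<notin> vec.span ?H" using g unfolding sp by simp
  ultimately have "vec.dim ?H + 1 = CARD('n)"
    by (simp add: vec.dim_insert)
  then show ?thesis using sub by (simp add: hyperplane_def)
qed

text \<open>All fibres of \<open>f \<mapsto> dot f y\<close> on \<open>F\<close> are translates of each other.\<close>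
lemma card_dot_eq_0:
  fixes F :: "('a::{field,finite} ^ 'n::finite) set"
  assumes g: "dot g y = 1" and F: "\<And>f c. f \<in> F \<Longrightarrow> f + c *s g \<in> F"
  shows "CARD('a) * card {f \<in> F. dot f y = 0} = card F"
proof -
  have fib: "card {f \<in> F. dot f y = c} = card {f \<in> F. dot f y = 0}" for c
  proof (rule bij_betw_same_card [of "\<lambda>f. f + (-c) *s g"],
         rule bij_betw_byWitness [where f' = "\<lambda>f. f + c *s g"])
  qed (use g F [of _ c] F [of _ "-c"] in \<open>auto simp: dot_add_left dot_diff_left dot_scale_left\<close>)
  have "card F = card (\<Union>c\<in>UNIV. {f \<in> F. dot f y = c})"
    by (rule arg_cong [of _ _ card]) auto
  also have "\<dots> = (\<Sum>c\<in>UNIV. card {f \<in> F. dot f y = c})"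
    by (rule card_UN_disjoint) auto
  also have "\<dots> = (\<Sum>c\<in>(UNIV :: 'a set). card {f \<in> F. dot f y = 0})"
    by (intro sum.cong refl fib)
  finally show ?thesis by simp
qed

lemma card_annihilator1:
  fixes x :: "'a::{field,finite} ^ 'n::finite"
  assumes "x \<noteq> 0"
  shows "CARD('a) * card {f. dot f x = 0} = CARD('a ^ 'n)"
  using exists_dot_eq_1 [OF assms] card_dot_eq_0 [of _ x UNIV] by auto

text \<open>On the annihilator of \<open>x\<close> evaluation at \<open>y\<close> still attains 1,
  so \<open>card_dot_eq_0\<close> applies a second time there and yields another factor
  \<open>CARD('a)\<close>.\<close>

lemma card_annihilator2:
  fixes x y :: "'a::{field,finite} ^ 'n::finite"
  assumes "x \<noteq> 0" and "\<And>c. y \<noteq> c *s x"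
  shows "CARD('a) ^ 2 * card {f. dot f x = 0 \<and> dot f y = 0} = CARD('a ^ 'n)"
proof -
  obtain g where "dot g x = 0" "dot g y = 1" using exists_dot_eq_0_1 [OF assms] by blast
  then have "CARD('a) * card {f \<in> {f. dot f x = 0}. dot f y = 0} = card {f. dot f x = 0}"
    by (intro card_dot_eq_0 [of g]) (auto simp: dot_add_left dot_scale_left)
  then show ?thesis using card_annihilator1 [OF assms(1)]
    by (simp add: power2_eq_square mult.assoc)
qed

section \<open>Zero counts of functionals: moments and divisibility\<close>

definition zeros :: "('a::field ^ 'n::finite) set \<Rightarrow> 'a ^ 'n \<Rightarrow> nat" where
  "zeros X f = card {x \<in> X. dot f x = 0}"

text \<open>Models a set of distinct projective points by one nonzero vector each.\<close>

definition projective :: "('a::field ^ 'n::finite) set \<Rightarrow> bool" where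
  "projective X \<longleftrightarrow> (\<forall>x\<in>X. x \<noteq> 0 \<and> (\<forall>y\<in>X. y \<noteq> x \<longrightarrow> (\<forall>c. y \<noteq> c *s x)))"

text \<open>All functionals are tested, so that sums run over a whole vector space;
  \<open>f = 0\<close> satisfies the congruence trivially.\<close>

definition divisible :: "nat \<Rightarrow> ('a::{field,finite} ^ 'n::finite) set \<Rightarrow> bool" where
  "divisible r X \<longleftrightarrow> (\<forall>f. [zeros X f = card X] (mod CARD('a) ^ r))"

lemma zeros_eq_sum: "int (zeros X f) = (\<Sum>x\<in>X. if dot f x = 0 then 1 else 0)"
  for X :: "('a::{field,finite} ^ 'n::finite) set"
  by (simp add: zeros_def sum.If_cases Int_def)

text \<open>Double counting: each vector of \<open>X\<close> is nonzero, hence killed by a fraction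
  1/q of all functionals.\<close>

lemma zeros_moment1:
  fixes X :: "('a::{field,finite} ^ 'n::finite) set"
  assumes "projective X"
  shows "int CARD('a) * (\<Sum>f\<in>UNIV. int (zeros X f)) = int (card X) * int CARD('a ^ 'n)"
proof -
  have "int CARD('a) * (\<Sum>f\<in>UNIV. int (zeros X f))
      = (\<Sum>x\<in>X. int CARD('a) * (\<Sum>f\<in>UNIV. if dot f x = 0 then 1 else 0))"
    unfolding zeros_eq_sum by (subst sum.swap) (simp add: sum_distrib_left)
  also have "\<dots> = (\<Sum>x\<in>X. int CARD('a ^ 'n))"
  proof (rule sum.cong)
    fix x assume "x \<in> X"
    then have "x \<noteq> 0" using assms by (auto simp: projective_def)
    then show "int CARD('a) * (\<Sum>f\<in>UNIV. if dot f x = 0 then 1 else 0) = int CARD('a ^ 'n)"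
      by (simp add: sum.If_cases card_annihilator1 flip: of_nat_mult)
  qed simp
  finally show ?thesis by simp
qed

text \<open>Counts ordered pairs of common zeros. Distinct vectors of \<open>X\<close> are
  independent and impose two conditions; diagonal pairs impose only one, whence the correction by
  \<open>q - 1\<close>.\<close>

lemma zeros_moment2:
  fixes X :: "('a::{field,finite} ^ 'n::finite) set"
  assumes "projective X"
  shows "(int CARD('a))\<^sup>2 * (\<Sum>f\<in>UNIV. (int (zeros X f))\<^sup>2)
    = int CARD('a ^ 'n) * int (card X) * (int CARD('a) + int (card X) - 1)"
proof -
  let ?q = "int CARD('a)" and ?N = "int CARD('a ^ 'n)"
  have sq: "(int (zeros X f))\<^sup>2 = (\<Sum>x\<in>X. \<Sum>y\<in>X. if dot f x = 0 \<and> dot f y = 0 then 1 else 0)" for f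
    unfolding zeros_eq_sum power2_eq_square sum_product
    by (intro sum.cong) auto
  have pair: "?q\<^sup>2 * (\<Sum>f\<in>UNIV. if dot f x = 0 \<and> dot f y = 0 then 1 else 0)
      = ?N + (if y = x then ?N * (?q - 1) else 0)" if "x \<in> X" "y \<in> X" for x y
  proof -
    have x: "x \<noteq> 0" using assms that by (auto simp: projective_def)
    have "?q\<^sup>2 * (\<Sum>f\<in>UNIV. if dot f x = 0 \<and> dot f y = 0 then 1 else 0)
        = int (CARD('a) ^ 2 * card {f. dot f x = 0 \<and> dot f y = 0})"
      by (simp add: sum.If_cases)
    also have "\<dots> = ?N + (if y = x then ?N * (?q - 1) else 0)"
    proof (cases "y = x")
      case True
      have "CARD('a) ^ 2 * card {f. dot f x = 0} = CARD('a) * CARD('a ^ 'n)"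
        by (simp only: power2_eq_square mult.assoc card_annihilator1 [OF x])
      with True show ?thesis by (simp add: algebra_simps del: of_nat_power CARD_vec flip: of_nat_mult)
    next
      case False
      then have "\<And>c. y \<noteq> c *s x" using assms that by (auto simp: projective_def)
      from card_annihilator2 [OF x this] False show ?thesis by simp
    qed
    finally show ?thesis .
  qed
  have "?q\<^sup>2 * (\<Sum>f\<in>UNIV. (int (zeros X f))\<^sup>2)
      = (\<Sum>x\<in>X. \<Sum>y\<in>X. ?q\<^sup>2 * (\<Sum>f\<in>UNIV. if dot f x = 0 \<and> dot f y = 0 then 1 else 0))"
    unfolding sq sum_distrib_left by (subst sum.swap) (intro sum.cong refl sum.swap)
  also have "\<dots> = (\<Sum>x\<in>X. \<Sum>y\<in>X. ?N + (if y = x then ?N * (?q - 1) else 0))"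
    by (intro sum.cong) (simp_all add: pair)
  also have "\<dots> = ?N * int (card X) * (?q + int (card X) - 1)"
    by (simp add: sum.distrib algebra_simps)
  finally show ?thesis .
qed

text \<open>Sum over the pencil of functionals \<open>k + c *s h\<close>: every vector off the kernel of \<open>h\<close> lies in
  exactly one of their kernels, every common zero of \<open>h\<close> and \<open>k\<close> in all \<open>q\<close> of them.\<close>
lemma divisible_restrict:
  fixes X :: "('a::{field,finite} ^ 'n::finite) set"
  assumes "divisible (Suc r) X"
  shows "divisible r {x \<in> X. dot h x = 0}"
  unfolding divisible_def
proof
  fix k
  let ?q = "CARD('a)" and ?Y = "{x \<in> X. dot h x = 0}"
  have cong: "[int (zeros X f) = int (card X)] (mod int ?q ^ Suc r)" for f
    using assms unfolding divisible_def cong_int_iff [symmetric] by simp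
  have point: "(\<Sum>c\<in>UNIV. if dot (k + c *s h) x = 0 then 1 else 0)
      = (if dot h x = 0 then (if dot k x = 0 then int ?q else 0) else 1)" for x
  proof (cases "dot h x = 0")
    case True
    then show ?thesis by (simp add: dot_add_left dot_scale_left)
  next
    case False
    then have "dot (k + c *s h) x = 0 \<longleftrightarrow> c = - dot k x / dot h x" for c
      by (auto simp: dot_add_left dot_scale_left field_simps add_eq_0_iff)
    with False show ?thesis by simp
  qed
  have "(\<Sum>c\<in>UNIV. int (zeros X (k + c *s h)))
      = (\<Sum>x\<in>X. if dot h x = 0 then (if dot k x = 0 then int ?q else 0) else 1)"
    unfolding zeros_eq_sum by (subst sum.swap) (simp add: point)
  also have "\<dots> = int ?q * int (zeros ?Y k) + int (card {x \<in> X. dot h x \<noteq> 0})"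
  proof -
    have "{x \<in> X. dot h x = 0} \<inter> {x. dot k x = 0} = {x \<in> ?Y. dot k x = 0}" by auto
    then show ?thesis by (simp add: zeros_def sum.If_cases Int_def)
  qed
  also have "int (card {x \<in> X. dot h x \<noteq> 0}) = int (card X) - int (zeros X h)"
  proof -
    have "{x \<in> X. dot h x \<noteq> 0} = X - ?Y" by auto
    then have "card {x \<in> X. dot h x \<noteq> 0} + card ?Y = card X"
      using card_Diff_subset [of ?Y X] card_mono [of X ?Y] by auto
    then show ?thesis unfolding zeros_def by linarith
  qed
  finally have eq: "int ?q * int (zeros ?Y k)
      = (\<Sum>c\<in>UNIV. int (zeros X (k + c *s h))) - (int (card X) - int (zeros X h))" by simp
  \<comment> \<open>Modulo q^(r+1) every zero count of \<open>X\<close> may be replaced by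
    \<open>card X\<close>. Cancelling the factor \<open>?q\<close> afterwards costs one power of
    q.\<close>
  have "[int ?q * int (zeros ?Y k) = (\<Sum>c\<in>(UNIV::'a set). int (card X)) - (int (card X) - int (card X))]
      (mod int ?q ^ Suc r)"
    unfolding eq by (intro cong_diff cong_sum cong cong_refl)
  then have "[int (zeros ?Y k) = int (card X)] (mod int ?q ^ r)"
    by (simp add: cong_iff_dvd_diff flip: right_diff_distrib)
  moreover have "[int (card ?Y) = int (card X)] (mod int ?q ^ r)"
    using cong_dvd_modulus [OF cong [of h]] by (simp add: zeros_def)
  ultimately have "[int (zeros ?Y k) = int (card ?Y)] (mod int (?q ^ r))"
    unfolding of_nat_power using cong_sym cong_trans by blast
  then show "[zeros ?Y k = card ?Y] (mod ?q ^ r)" by (simp only: cong_int_iff)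
qed

lemma projective_subset: "projective X \<Longrightarrow> Y \<subseteq> X \<Longrightarrow> projective Y"
  unfolding projective_def by blast

text \<open>By \<open>zeros_moment1\<close> the mean of \<open>zeros X f\<close> over all
  \<open>f\<close> is \<open>card X\<close> divided by q, and some value does not exceed the
  mean.\<close>

lemma exists_small_zeros:
  fixes X :: "('a::{field,finite} ^ 'n::finite) set"
  assumes "projective X"
  shows "\<exists>f. CARD('a) * zeros X f \<le> card X"
proof (rule ccontr)
  assume "\<not> ?thesis"
  then have "card X < CARD('a) * zeros X f" for f by (simp add: not_le)
  then have "int (card X) < int CARD('a) * int (zeros X f)" for f
    by (metis of_nat_less_iff of_nat_mult)
  then have "(\<Sum>f\<in>(UNIV::('a^'n) set). int (card X)) < (\<Sum>f\<in>UNIV. int CARD('a) * int (zeros X f))"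
    by (intro sum_strict_mono) auto
  then show False using zeros_moment1 [OF assms] by (simp add: mult.commute flip: sum_distrib_left)
qed

section \<open>The quadratic inequality from the first two moments\<close>

lemma mult_consecutive_nonneg: "0 \<le> t * (t - 1)" for t :: int
  by (cases "t \<le> 0") (auto intro: mult_nonpos_nonpos)

lemma divisible_quotient:
  fixes X :: "('a::{field,finite} ^ 'n::finite) set"
  assumes "divisible r X"
  obtains t where "int (card X) - int (zeros X f) = t * int CARD('a) ^ r"
proof -
  have "[int (card X) = int (zeros X f)] (mod int (CARD('a) ^ r))"
    using assms by (simp only: divisible_def cong_int_iff cong_sym)
  then show thesis using that by (auto simp: cong_iff_dvd_diff dvd_def mult.commute)
qed

text \<open>As \<open>f\<close> varies, q * (\<open>card X\<close> - \<open>zeros X f\<close>) is an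
  integer multiple \<open>t * Q\<close> of \<open>Q\<close>; by the two moments its mean and its
  variance both equal \<open>y\<close>. The right-hand side is therefore the mean of
  \<open>(t * Q - m * Q) * (t * Q - (m + 1) * Q)\<close>, a quantity that is never negative.\<close>

lemma divisible_quadratic:
  fixes X :: "('a::{field,finite} ^ 'n::finite) set" and m :: int
  assumes "projective X" and "divisible r X"
    and "y = int (card X) * (int CARD('a) - 1)" and "Q = int CARD('a) ^ (r + 1)"
  shows "0 \<le> (y - m * Q) * (y - (m + 1) * Q) + y"
proof -
  let ?q = "int CARD('a)" and ?N = "int CARD('a ^ 'n)" and ?n = "int (card X)"
  define \<alpha> \<beta> where "\<alpha> = ?q * ?n - m * Q" and "\<beta> = ?q * ?n - (m + 1) * Q"
  have nonneg: "0 \<le> (\<alpha> - ?q * int (zeros X f)) * (\<beta> - ?q * int (zeros X f))" for f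
  proof -
    obtain t where t: "?n - int (zeros X f) = t * ?q ^ r" using divisible_quotient [OF assms(2)] .
    then have "?q * ?n = ?q * int (zeros X f) + t * Q" unfolding assms(4)
      by (simp add: algebra_simps)
    then have "(\<alpha> - ?q * int (zeros X f)) * (\<beta> - ?q * int (zeros X f)) = Q\<^sup>2 * ((t - m) * (t - m - 1))"
      unfolding \<alpha>_def \<beta>_def by (simp add: power2_eq_square algebra_simps)
    then show ?thesis using mult_consecutive_nonneg [of "t - m"] by simp
  qed
  have "0 \<le> (\<Sum>f\<in>UNIV. (\<alpha> - ?q * int (zeros X f)) * (\<beta> - ?q * int (zeros X f)))"
    by (intro sum_nonneg nonneg)
  also have "\<dots> = (\<Sum>f\<in>(UNIV::('a^'n) set). \<alpha> * \<beta> - (\<alpha> + \<beta>) * (?q * int (zeros X f)) + ?q\<^sup>2 * (int (zeros X f))\<^sup>2)"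
    by (intro sum.cong) (auto simp: power2_eq_square algebra_simps)
  also have "\<dots> = ?N * (\<alpha> * \<beta>) - (\<alpha> + \<beta>) * (?q * (\<Sum>f\<in>UNIV. int (zeros X f)))
      + ?q\<^sup>2 * (\<Sum>f\<in>UNIV. (int (zeros X f))\<^sup>2)"
    by (simp add: sum.distrib sum_subtractf sum_distrib_left)
  also have "\<dots> = ?N * ((y - m * Q) * (y - (m + 1) * Q) + y)"
    unfolding zeros_moment1 [OF assms(1)] zeros_moment2 [OF assms(1)] \<alpha>_def \<beta>_def assms(3)
    by (simp add: algebra_simps del: CARD_vec)
  finally show ?thesis using zero_less_card_finite [where 'a = "'a^'n"]
    by (simp add: zero_le_mult_iff del: CARD_vec)
qed

section \<open>Numerical estimates\<close>

text \<open>The coefficient \<open>2 * r - 1\<close> is large enough for the induction step of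
  \<open>power_lower_quadratic\<close> at \<open>p = 1\<close>, and for
  \<open>2 * m < A + p - 2\<close> in \<open>quadratic_gap\<close>.\<close>

lemma power_lower_linear:
  fixes p :: int
  assumes "p \<ge> 1" "r \<ge> 1"
  shows "(2 * int r - 1) * p + 1 \<le> (p + 1) ^ r"
  using assms(2)
proof (induction r rule: nat_induct_at_least)
  case (Suc r)
  have "1 \<le> (2 * int r - 1) * p" using assms(1) Suc.hyps mult_mono [of 1 "2 * int r - 1" 1 p] by simp
  then have "2 * p \<le> p * ((2 * int r - 1) * p + 1)" using assms(1) by simp
  then show ?case using mult_left_mono [OF Suc.IH, of "p + 1"] assms(1) by (simp add: algebra_simps)
qed simp

lemma power_lower_quadratic:
  fixes p :: int
  assumes "p \<ge> 1" "r \<ge> 1"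
  shows "int r * (int r * p - 1) < (p + 1) ^ r"
  using assms(2)
proof (induction r rule: nat_induct_at_least)
  case (Suc r)
  \<comment> \<open>The two sides are the increments of \<open>r * (r * p - 1)\<close> and of
    \<open>(p + 1) ^ r\<close> from \<open>r\<close> to \<open>Suc r\<close>.\<close>
  have *: "2 * int r * p + p - 1 \<le> p * (p + 1) ^ r"
  proof (cases "p = 1")
    case True
    then show ?thesis using power_lower_linear [OF assms(1) Suc.hyps] by simp
  next
    case False
    then have "(2 * int r - 1) * 2 \<le> (2 * int r - 1) * p" using assms(1) Suc.hyps
      by (intro mult_left_mono) auto
    moreover have "2 * int r + 1 \<le> (2 * int r - 1) * 2 + 1" using Suc.hyps by simp
    ultimately have "2 * int r + 1 \<le> (p + 1) ^ r"
      using power_lower_linear [OF assms(1) Suc.hyps] by linarith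
    from mult_left_mono [OF this, of p] assms(1) show ?thesis by (simp add: algebra_simps)
  qed
  show ?case using Suc.IH * by (simp add: algebra_simps)
qed simp

text \<open>On \<open>[\<zeta>, K - \<zeta>]\<close> the concave function \<open>z * (K - z)\<close> is minimal at the ends.\<close>
lemma quadratic_gap:
  fixes p A m z :: int
  assumes p: "p \<ge> 1" and r: "r \<ge> 1" and A: "A = (p + 1) ^ r" and Q: "Q = (p + 1) * A"
    and m: "0 \<le> m" "m \<le> int r * p - 1"
    and z: "A + p - 1 - m \<le> z" "z \<le> Q - 1 - p - m"
  shows "m * Q < z * (Q - 1 - z)"
proof -
  define K where "K = Q - 1"
  have ends: "m * Q < \<zeta> * (K - \<zeta>)" if "\<zeta> = A + p - 1 - m \<or> \<zeta> = p + m" for \<zeta>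
    using that
  proof
    assume \<zeta>: "\<zeta> = p + m"
    let ?R = "int (Suc r)"
    \<comment> \<open>After cancelling \<open>m * Q\<close> the claim reads
      \<open>(p + m) * (p + m + 1) < p * Q\<close>.\<close>
    have "p + m \<le> ?R * p - 1" using m by (simp add: algebra_simps)
    then have "(p + m) * (p + m + 1) \<le> (?R * p - 1) * (?R * p)"
      using p m by (intro mult_mono) auto
    also have "\<dots> = p * (?R * (?R * p - 1))" by (simp add: algebra_simps)
    also have "\<dots> < p * Q"
      using power_lower_quadratic [of p "Suc r"] p A Q by simp
    finally show ?thesis by (simp add: \<zeta> K_def algebra_simps)
  next
    assume \<zeta>: "\<zeta> = A + p - 1 - m"
    \<comment> \<open>Here the claim expands to
      \<open>(m - p) * (m - p + 1) < p * A * (A + p - 2 - 2 * m)\<close>.\<close>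
    have "(m - p) * (m - p + 1) \<le> (int r * p) * (int r * p - 1)"
    proof (cases "m \<ge> p")
      case True
      with m p show ?thesis
        by (subst mult.commute, intro mult_mono) auto
    next
      case False
      have "p \<le> int r * p" using mult_right_mono [of 1 "int r" p] p r by simp
      have "(p - m) * (p - m - 1) \<le> (int r * p) * (int r * p - 1)"
        using False m p \<open>p \<le> int r * p\<close> by (intro mult_mono) linarith+
      then show ?thesis by (simp add: algebra_simps)
    qed
    also have "\<dots> < p * A"
      using power_lower_quadratic [OF p r] p A by (simp add: mult.commute mult.left_commute)
    also have "\<dots> \<le> p * A * (A + p - 2 - 2 * m)"
    proof -
      have "1 \<le> A + p - 2 - 2 * m"
        using power_lower_linear [OF p r] m A by (simp add: algebra_simps)
      moreover have "0 \<le> p * A" using p A by simp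
      ultimately show ?thesis using mult_left_mono [of 1 "A + p - 2 - 2 * m" "p * A"] by simp
    qed
    finally show ?thesis by (simp add: \<zeta> K_def Q algebra_simps)
  qed
  \<comment> \<open>The range of \<open>z\<close> is bounded by \<open>A + p - 1 - m\<close> and
    \<open>K - (p + m)\<close>; taking the smaller offset encloses it in an interval symmetric about
    K/2.\<close>
  define \<zeta> where "\<zeta> = min (A + p - 1 - m) (p + m)"
  have "0 \<le> (z - \<zeta>) * (K - \<zeta> - z)"
    using z by (intro mult_nonneg_nonneg) (auto simp: \<zeta>_def K_def)
  then have "\<zeta> * (K - \<zeta>) \<le> z * (K - z)" by (simp add: algebra_simps)
  moreover have "m * Q < \<zeta> * (K - \<zeta>)" by (rule ends) (auto simp: \<zeta>_def min_def)
  ultimately show ?thesis by (simp add: K_def)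
qed

section \<open>Excluding the gap cardinalities by induction\<close>

text \<open>Integer parameters let the induction form \<open>a - u\<close> before its sign is known,
  and make \<open>r = 0\<close> vacuous because \<open>a\<close> would have to be at most
  -1.\<close>

lemma divisible_card_gap:
  fixes X :: "('a::{field,finite} ^ 'n::finite) set" and a b c s :: int
  assumes "projective X" and "divisible r X"
    and "(int CARD('a) - 1) * s = int CARD('a) ^ (r + 1) - 1"
    and "0 \<le> a" "a \<le> int r - 1" "0 \<le> b" "b \<le> int CARD('a) - 2"
    and "a + 1 \<le> c" "c \<le> s - 1"
    and "int (card X) = (a * (int CARD('a) - 1) + b) * s + c"
  shows False
  using assms
proof (induction r arbitrary: X a b c s)
  case 0
  then show ?case by simp
next
  case (Suc r)
  define p where "p = int CARD('a) - 1"
  define A where "A = int CARD('a) ^ Suc r"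
  define Q where "Q = int CARD('a) ^ (Suc r + 1)"
  define m where "m = a * p + b"
  define s' where "s' = s - A"
  have q: "int CARD('a) = p + 1" by (simp add: p_def)
  have p: "p \<ge> 1" and bp: "b \<le> p - 1" using Suc.prems(6,7) by (auto simp: p_def)
  have Q: "Q = (p + 1) * A" by (simp add: Q_def A_def q)
  have A: "A > 0" using p by (simp add: A_def q)
  have s: "p * s = Q - 1" using Suc.prems(3) by (simp add: Q_def p_def)
  have s': "p * s' = A - 1" using s by (simp add: s'_def Q algebra_simps)
  have "0 \<le> s'"
    using s' p A by (smt (verit) mult_pos_neg)
  have "0 \<le> a * p" using Suc.prems(4) p by simp
  then have m0: "0 \<le> m" using Suc.prems(6) by (simp add: m_def)
  have "a * p \<le> int r * p" using Suc.prems(5) p by (intro mult_right_mono) auto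
  then have m1: "m \<le> int (Suc r) * p - 1" using bp by (simp add: m_def algebra_simps)
  have n: "int (card X) = m * s + c" using Suc.prems(10) by (simp add: m_def p_def)
  have y: "int (card X) * p = m * Q - m + c * p"
  proof -
    have "int (card X) * p = m * (p * s) + c * p" by (simp add: n algebra_simps)
    then show ?thesis by (simp add: s algebra_simps)
  qed
  show ?case
  proof (cases "c \<le> s'")
    case False
    \<comment> \<open>With this \<open>z\<close>, \<open>card X * p = m * Q + z\<close>, so
      \<open>divisible_quadratic\<close> says \<open>z * (Q - 1 - z)\<close> is at most
      \<open>m * Q\<close>, the opposite of \<open>quadratic_gap\<close>.\<close>
    define z where "z = c * p - m"
    have "(s' + 1) * p \<le> c * p" using False p by (intro mult_right_mono) auto
    then have z0: "A + p - 1 - m \<le> z" using s' by (simp add: z_def algebra_simps)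
    have "c * p \<le> (s - 1) * p" using Suc.prems(9) p by (intro mult_right_mono) auto
    then have z1: "z \<le> Q - 1 - p - m" using s by (simp add: z_def algebra_simps)
    have "m * Q < z * (Q - 1 - z)"
      using quadratic_gap [of p "Suc r" A Q m z] p m0 m1 Q z0 z1 by (simp add: A_def q)
    moreover have "0 \<le> (int (card X) * p - m * Q) * (int (card X) * p - (m + 1) * Q) + int (card X) * p"
      using divisible_quadratic [OF Suc.prems(1,2)] unfolding p_def Q_def by blast
    then have "0 \<le> z * (z - Q) + m * Q + z" unfolding y by (simp add: z_def algebra_simps)
    ultimately show False by (simp add: algebra_simps)
  next
    case True
    obtain f where f: "CARD('a) * zeros X f \<le> card X"
      using exists_small_zeros [OF Suc.prems(1)] by blast
    obtain t where t: "int (card X) - int (zeros X f) = t * A"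
      using divisible_quotient [OF Suc.prems(2)] unfolding A_def .
    have "(p + 1) * int (zeros X f) \<le> int (card X)"
      using f unfolding q [symmetric] by (metis of_nat_le_iff of_nat_mult)
    moreover have "int (zeros X f) = int (card X) - t * A" using t by simp
    ultimately have "int (card X) * p \<le> t * Q" by (simp add: Q algebra_simps)
    \<comment> \<open>The lower end \<open>a + 1\<close> of the gap enters here:
      \<open>b < p\<close> gives \<open>m < (a + 1) * p\<close>. Hence \<open>card X * p\<close>
      exceeds \<open>m * Q\<close>, which forces \<open>t > m\<close>.\<close>
    moreover have "m < c * p"
    proof -
      have "(a + 1) * p \<le> c * p" using Suc.prems(8) p by (intro mult_right_mono) auto
      then show ?thesis using bp by (simp add: m_def algebra_simps)
    qed
    ultimately have "m * Q < t * Q" using y by linarith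
    then have "m < t" using A p Q by simp
    define u where "u = t - m"
    have u: "1 \<le> u" using \<open>m < t\<close> by (simp add: u_def)
    let ?Y = "{x \<in> X. dot f x = 0}"
    have "int (card ?Y) = m * s + c - t * A" using t n by (simp add: zeros_def)
    \<comment> \<open>Since \<open>A - 1 = p * s'\<close>, the surplus \<open>u\<close> of
      \<open>t\<close> over \<open>m\<close> lowers both \<open>a\<close> and \<open>c\<close> by
      \<open>u\<close>.\<close>
    also have "\<dots> = m * s' - u * (A - 1) + (c - u)" by (simp add: u_def s'_def algebra_simps)
    also have "\<dots> = ((a - u) * p + b) * s' + (c - u)"
      unfolding s' [symmetric] by (simp add: m_def algebra_simps)
    finally have card_Y: "int (card ?Y) = ((a - u) * p + b) * s' + (c - u)" .
    show False
    proof (cases "u \<le> a")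
      case True
      show False
      \<comment> \<open>The bound \<open>c - u \<le> s' - 1\<close> comes from
        \<open>c \<le> s'\<close> and \<open>u \<ge> 1\<close>.\<close>
      proof (rule Suc.IH [of ?Y s' "a - u" b "c - u"])
        show "projective ?Y" by (rule projective_subset [OF Suc.prems(1)]) simp
        show "divisible r ?Y" by (rule divisible_restrict [OF Suc.prems(2)])
        show "int (card ?Y) = ((a - u) * (int CARD('a) - 1) + b) * s' + (c - u)"
          using card_Y by (simp add: p_def)
        show "(int CARD('a) - 1) * s' = int CARD('a) ^ (r + 1) - 1"
          using s' by (simp add: p_def A_def)
        show "a - u \<le> int r - 1" using u Suc.prems(5) by simp
      qed (use True u Suc.prems(4,6,7,8) \<open>c \<le> s'\<close> in linarith)+
    next
      case False
      \<comment> \<open>As \<open>b < p\<close>, the coefficient of \<open>s'\<close> is at most -1,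
        so the cardinality would be at most \<open>c - u - s'\<close>, which is negative.\<close>
      then have "(a - u) * p \<le> (-1) * p" using p by (intro mult_right_mono) auto
      then have "((a - u) * p + b) * s' \<le> (-1) * s'"
        using bp \<open>0 \<le> s'\<close> by (intro mult_right_mono) auto
      then show False using card_Y \<open>c \<le> s'\<close> u by linarith
    qed
  qed
qed

section \<open>From points to vectors, and the theorem\<close>

text \<open>Choose a spanning vector of each point. A point lies in a kernel exactly when its vector
  does, and kernels of nonzero functionals are hyperplanes, so divisibility carries over.\<close>

lemma representatives:
  fixes \<C> :: "('a::{field,finite} ^ 'n::finite) set set"
  assumes "divisible_set r \<C>"
  obtains X :: "('a ^ 'n) set" where "projective X" "divisible r X" "card X = card \<C>"
proof -
  have pt: "\<exists>x. x \<noteq> 0 \<and> P = vec.span {x}" if "P \<in> \<C>" for P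
  proof -
    have P: "vec.subspace P" "vec.dim P = 1"
      using assms that by (auto simp: divisible_set_def point_def)
    obtain B where B: "B \<subseteq> P" "vec.independent B" "P \<subseteq> vec.span B" "card B = 1"
      using vec.basis_exists [of P] P(2) by metis
    then obtain x where "B = {x}"
      by (auto simp: card_1_singleton_iff)
    moreover have "vec.span B = P" using vec.span_minimal [OF B(1) P(1)] B(3) by (rule subset_antisym)
    moreover have "x \<noteq> 0" using B(2) vec.dependent_zero [of "{x}"] \<open>B = {x}\<close> by auto
    ultimately show ?thesis by blast
  qed
  then obtain g where g: "\<And>P. P \<in> \<C> \<Longrightarrow> g P \<noteq> 0" "\<And>P. P \<in> \<C> \<Longrightarrow> P = vec.span {g P}"
    by metis
  have inj: "inj_on g \<C>" by (rule inj_onI) (metis g(2))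
  let ?X = "g ` \<C>"
  have "projective ?X"
    unfolding projective_def
  proof (intro ballI conjI impI allI)
    fix x y c assume x: "x \<in> ?X" and y: "y \<in> ?X" and "y \<noteq> x"
    show "y \<noteq> c *s x"
    proof
      assume eq: "y = c *s x"
      have "c \<noteq> 0" using eq y g(1) by auto
      then have "vec.span {y} = vec.span {x}"
        unfolding eq using vec.span_image_scale [of "{x}" "\<lambda>_. c"] by simp
      then show False using x y \<open>y \<noteq> x\<close> g(2) by (metis imageE)
    qed
  qed (use g(1) in auto)
  moreover have card: "card ?X = card \<C>" by (rule card_image [OF inj])
  moreover have "divisible r ?X"
    unfolding divisible_def
  proof
    fix f :: "'a ^ 'n"
    show "[zeros ?X f = card ?X] (mod CARD('a) ^ r)"
    proof (cases "f = 0")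
      case True
      then show ?thesis by (simp add: zeros_def)
    next
      case False
      let ?H = "{x. dot f x = 0}"
      note H = hyperplane_kernel [OF False]
      have "P \<subseteq> ?H \<longleftrightarrow> dot f (g P) = 0" if "P \<in> \<C>" for P
      proof -
        have "vec.span {g P} \<subseteq> ?H \<longleftrightarrow> {g P} \<subseteq> ?H"
          using H by (metis hyperplane_def vec.span_minimal vec.span_superset subset_trans)
        then show ?thesis using g(2) [OF that] by simp
      qed
      then have "{x \<in> ?X. dot f x = 0} = g ` {P \<in> \<C>. P \<subseteq> ?H}" by auto
      moreover have "card (g ` {P \<in> \<C>. P \<subseteq> ?H}) = card {P \<in> \<C>. P \<subseteq> ?H}"
        by (rule card_image, rule inj_on_subset [OF inj]) auto
      ultimately show ?thesis
        using assms H card by (simp add: zeros_def divisible_set_def)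
    qed
  qed
  ultimately show thesis using that by blast
qed

theorem theorem12:
  fixes \<C> :: "('a::{field,finite} ^ 'n::finite) set set" and q r n :: nat
  assumes "q = CARD('a)"
    and "r > 0"
    and "divisible_set r \<C>"
    and "n = card \<C>"
  shows "(\<forall>a b :: nat. b \<le> q - 2 \<and> a \<le> r - 1 \<longrightarrow>
            n \<notin> {(a * (q - 1) + b) * ((q ^ (r + 1) - 1) div (q - 1)) + a + 1 ..
                 (a * (q - 1) + b + 1) * ((q ^ (r + 1) - 1) div (q - 1)) - 1}) \<and>
         (n \<le> r * q ^ (r + 1) \<longrightarrow>
            (\<exists>a b :: nat. n = a * ((q ^ (r + 1) - 1) div (q - 1)) + b * q ^ (r + 1)))"
proof -
  obtain X :: "('a ^ 'n) set" where X: "projective X" "divisible r X" "card X = n"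
    using representatives [OF assms(3)] assms(4) by metis
  have "card {0, 1 :: 'a} \<le> CARD('a)" by (rule card_mono) auto
  then have "q \<ge> 2" by (simp add: assms(1))
  define p where "p = q - 1"
  have p: "p \<ge> 1" "q = p + 1" using \<open>q \<ge> 2\<close> by (auto simp: p_def)
  define s where "s = (q ^ (r + 1) - 1) div (q - 1)"
  have "int (q ^ (r + 1) - 1) = (int q) ^ (r + 1) - 1"
    using p(2) by (subst of_nat_diff) (simp_all del: power_Suc)
  moreover have "int p dvd (int q) ^ (r + 1) - 1"
    unfolding power_diff_1_eq p(2) by simp
  ultimately have "p dvd q ^ (r + 1) - 1" by (metis int_dvd_int_iff)
  then have ps: "p * s = q ^ (r + 1) - 1" by (simp add: s_def p_def)
  then have Q: "q ^ (r + 1) = p * s + 1" using p by simp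
  have intQ: "int p * int s + 1 = (int p + 1) ^ (r + 1)"
  proof -
    have "int p * int s + 1 = int (q ^ (r + 1))" unfolding Q by simp
    also have "\<dots> = (int p + 1) ^ (r + 1)"
      by (simp only: p(2) of_nat_power of_nat_add of_nat_1)
    finally show ?thesis .
  qed
  \<comment> \<open>Used for the positivity of \<open>s\<close> and, at the end, to bound the
    quotient of \<open>n\<close> by \<open>s\<close>.\<close>
  have rs: "r < s"
  proof -
    have "(2 * int (r + 1) - 1) * int p + 1 \<le> int p * int s + 1"
      unfolding intQ by (rule power_lower_linear) (use p(1) in auto)
    then have "(2 * int (r + 1) - 1) * int p \<le> int s * int p" by (simp add: mult.commute)
    then have "2 * int (r + 1) - 1 \<le> int s" using p(1) by (subst (asm) mult_le_cancel_right) auto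
    then show ?thesis by simp
  qed
  have gap: "False" if "b \<le> q - 2" "a \<le> r - 1" "a + 1 \<le> c" "c < s" "n = (a * p + b) * s + c" for a b c
  proof (rule divisible_card_gap [OF X(1,2), of "int s" "int a" "int b" "int c"])
    show "(int CARD('a) - 1) * int s = int CARD('a) ^ (r + 1) - 1"
      unfolding assms(1) [symmetric] p(2) of_nat_add of_nat_1 intQ [symmetric] by simp
    show "int (card X) = (int a * (int CARD('a) - 1) + int b) * int s + int c"
      unfolding assms(1) [symmetric] p(2) X(3) that(5) by simp
    show "int b \<le> int CARD('a) - 2" using that(1) \<open>q \<ge> 2\<close> unfolding assms(1) [symmetric] by linarith
  qed (use that(2-4) assms(2) in linarith)+
  have "n \<notin> {(a * p + b) * s + a + 1..(a * p + b + 1) * s - 1}" if "b \<le> q - 2" "a \<le> r - 1" for a b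
  proof
    assume *: "n \<in> {(a * p + b) * s + a + 1..(a * p + b + 1) * s - 1}"
    define c where "c = n - (a * p + b) * s"
    have "a + 1 \<le> c" and "n = (a * p + b) * s + c" using * unfolding c_def atLeastAtMost_iff by linarith+
    \<comment> \<open>Positivity of \<open>s\<close> keeps the natural subtraction of 1 at the upper
      end from truncating.\<close>
    moreover have "c < s"
    proof -
      have "(a * p + b + 1) * s = (a * p + b) * s + s" by simp
      then show ?thesis using * rs unfolding c_def atLeastAtMost_iff by linarith
    qed
    ultimately show False using gap [OF that] by blast
  qed
  moreover have "\<exists>a b. n = a * s + b * q ^ (r + 1)" if "n \<le> r * q ^ (r + 1)"
  proof -
    \<comment> \<open>As \<open>q ^ (r + 1) = p * s + 1\<close>, the remainder \<open>c\<close> can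
      be absorbed into \<open>c\<close> copies of \<open>q ^ (r + 1)\<close> at the price of
      \<open>c * p\<close> copies of \<open>s\<close>; this works once
      \<open>c * p \<le> m\<close>.\<close>
    define m c where "m = n div s" and "c = n mod s"
    have n: "n = m * s + c" and c: "c < s" using rs by (auto simp: m_def c_def)
    have "c * p \<le> m"
    proof (cases "m < r * p")
      case True
      \<comment> \<open>Division by \<open>p\<close> supplies the \<open>a\<close> and
        \<open>b\<close> of the gap, and avoiding the gap forces \<open>c\<close> to be at most
        \<open>a\<close>.\<close>
      have ab: "m = (m div p) * p + m mod p" by simp
      have "m mod p \<le> q - 2" using p mod_less_divisor [of p m] by linarith
      moreover have "m div p \<le> r - 1" using True p less_mult_imp_div_less [of m r p] by linarith
      ultimately have "c \<le> m div p" using gap [of "m mod p" "m div p" c] c n ab by force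
      then have "c * p \<le> (m div p) * p" by simp
      also have "\<dots> \<le> m" using ab by linarith
      finally show ?thesis .
    next
      case False
      \<comment> \<open>This is the hypothesis on \<open>n\<close> with \<open>q ^ (r + 1)\<close>
        expanded; because \<open>r < s\<close> it leaves only \<open>m = r * p\<close> and
        \<open>c \<le> r\<close>.\<close>
      have le: "m * s + c \<le> r * p * s + r" using that n unfolding Q by (simp add: algebra_simps)
      have "\<not> r * p + 1 \<le> m"
      proof
        assume "r * p + 1 \<le> m"
        then have "(r * p + 1) * s \<le> m * s" by (rule mult_right_mono) simp
        then show False using le rs by simp
      qed
      then have "m = r * p" using False by simp
      with le show ?thesis by simp
    qed
    then have "n = (m - c * p) * s + c * q ^ (r + 1)"
      unfolding n Q by (simp add: algebra_simps diff_mult_distrib)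
    then show ?thesis by blast
  qed
  ultimately show ?thesis unfolding s_def p_def by blast
qed

end
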